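(* Let $h\in\mathbb{H}$. Then $h\in\mathbb{H}(\mathbb{Q})$ if and only if there exist $n\ge 0$ and a finite sequence $\gamma_0,\gamma_1,\dots,\gamma_n$ of elements of $\mathbb{H}(\mathbb{Z})$ such that $h=\mathbb{K}\{\gamma_i\}_{i=0}^n:=\gamma_0*\iota\big(\gamma_1*\iota(\gamma_2*\cdots\iota(\gamma_n)\cdots)\big)$ (the expression being defined, i.e. $\iota$ is never applied to $0$).
   Context: The Heisenberg group $\mathbb{H}$ is $\mathbb{C}\times\mathbb{R}$ with group law $(z,t)*(z',t')=(z+z',\,t+t'+2\,\mathrm{Im}(\overline{z}z'))$; identity $0=(0,0)$, inverse $(z,t)^{-1}=(-z,-t)$. The Korányi inversion $\iota:\mathbb{H}\setminus\{0\}\to\mathbb{H}\setminus\{0\}$ is $\iota(z,t)=\left(\frac{-z}{|z|^2+\mathrm{i}t},\frac{-t}{|z|^4+t^2}\right)$. $\mathbb{H}(\mathbb{Z})=\mathbb{Z}[\mathrm{i}]\times\mathbb{Z}$ and $\mathbb{H}(\mathbb{Q})=\mathbb{Q}[\mathrm{i}]\times\mathbb{Q}$ (points with all rational coordinates). *)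

theory Defs
  imports "HOL-Analysis.Analysis"
begin

text \<open>The identity of the Heisenberg group is the zero \<open>(0, 0)\<close> of the product type.\<close>

type_synonym heis = "complex \<times> real"

definition heis_mult :: "heis \<Rightarrow> heis \<Rightarrow> heis"  (infixl \<open>\<odot>\<close> 70) where
  "p \<odot> q = (fst p + fst q, snd p + snd q + 2 * Im (cnj (fst p) * fst q))"

text \<open>Only meaningful away from \<open>0\<close>; by the convention \<open>x / 0 = 0\<close> the value at \<open>0\<close> is \<open>0\<close>,
  so wherever the inversion is used, its argument has to be required to be nonzero.\<close>

definition koranyi_inv :: "heis \<Rightarrow> heis" where
  "koranyi_inv p = (let z = fst p; t = snd p in
     (- z / (complex_of_real ((cmod z)\<^sup>2) + \<i> * complex_of_real t),
      - t / ((cmod z) ^ 4 + t\<^sup>2)))"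

definition gaussian_ints :: "complex set" where
  "gaussian_ints = {z. Re z \<in> \<int> \<and> Im z \<in> \<int>}"

definition gaussian_rats :: "complex set" where
  "gaussian_rats = {z. Re z \<in> \<rat> \<and> Im z \<in> \<rat>}"

definition heis_int :: "heis set" where
  "heis_int = gaussian_ints \<times> \<int>"

definition heis_rat :: "heis set" where
  "heis_rat = gaussian_rats \<times> \<rat>"

text \<open>A finite sequence \<open>\<gamma>\<^sub>0, \<dots>, \<gamma>\<^sub>n\<close> is given by a function \<open>\<gamma>\<close> on the naturals together with \<open>n\<close>;
  values beyond \<open>n\<close> are not used.\<close>

fun heis_cfrac :: "(nat \<Rightarrow> heis) \<Rightarrow> nat \<Rightarrow> heis" where
  "heis_cfrac \<gamma> 0 = \<gamma> 0"
| "heis_cfrac \<gamma> (Suc n) = \<gamma> 0 \<odot> koranyi_inv (heis_cfrac (\<lambda>i. \<gamma> (Suc i)) n)"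

text \<open>The inversion is never applied to \<open>0\<close> in the evaluation of \<open>heis_cfrac \<gamma> n\<close>.\<close>

fun heis_cfrac_defined :: "(nat \<Rightarrow> heis) \<Rightarrow> nat \<Rightarrow> bool" where
  "heis_cfrac_defined \<gamma> 0 \<longleftrightarrow> True"
| "heis_cfrac_defined \<gamma> (Suc n) \<longleftrightarrow>
     heis_cfrac_defined (\<lambda>i. \<gamma> (Suc i)) n \<and> heis_cfrac (\<lambda>i. \<gamma> (Suc i)) n \<noteq> 0"

end

theory Submission
  imports Defs
begin

text \<open>Attach to \<open>(z, t)\<close> the number \<open>w = |z|\<^sup>2 + i t\<close>. Left translation by \<open>(a, s)\<close> sends \<open>w\<close> to
  \<open>|a|\<^sup>2 + i s + w + 2 cnj a z\<close>, and the inversion sends \<open>(z, w)\<close> to \<open>(- z / w, 1 / w)\<close>. Hence if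
  \<open>z = r / q\<close> and \<open>w = p / q\<close> with Gaussian integers \<open>p, q, r\<close>, an integer translation keeps the
  denominator \<open>q\<close>, and the inversion replaces it by \<open>p\<close>. Since an integer translation can achieve
  \<open>|w| < 1\<close>, the denominators strictly decrease, as in the Euclidean algorithm.\<close>

definition siegel :: "heis \<Rightarrow> complex" where
  "siegel h = Complex ((cmod (fst h))\<^sup>2) (snd h)"

lemma siegel_eq_0_iff: "siegel h = 0 \<longleftrightarrow> h = 0"
  by (auto simp: siegel_def complex_eq_iff prod_eq_iff)

lemma siegel_mult: "siegel (g \<odot> h) = siegel g + siegel h + 2 * cnj (fst g) * fst h"
  by (simp add: siegel_def heis_mult_def complex_eq_iff cmod_power2)
    (simp add: power2_eq_square algebra_simps)

lemma norm_siegel_squared: "(cmod (siegel h))\<^sup>2 = cmod (fst h) ^ 4 + (snd h)\<^sup>2"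
proof -
  have "cmod (fst h) ^ 4 = ((cmod (fst h))\<^sup>2)\<^sup>2"
    by simp
  then show ?thesis
    by (simp only: cmod_power2 siegel_def complex.sel)
qed

lemma koranyi_inv_siegel:
  "koranyi_inv h = (- fst h / siegel h, - snd h / (cmod (siegel h))\<^sup>2)"
  by (simp add: koranyi_inv_def Let_def norm_siegel_squared)
    (simp add: siegel_def Complex_eq)

text \<open>With \<open>w = siegel h\<close>, the inverted point has real part
  \<open>|z|^2 / |w|^2\<close> and imaginary part \<open>- t / |w|^2\<close>, which together form
  \<open>cnj w / |w|^2\<close>. At \<open>h = 0\<close> both sides are \<open>0\<close> by the
  convention on division.\<close>

lemma siegel_koranyi_inv: "siegel (koranyi_inv h) = 1 / siegel h"
proof (cases "h = 0")
  case True
  then show ?thesis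
    by (simp add: koranyi_inv_siegel siegel_def Complex_eq)
next
  case False
  then have "siegel h \<noteq> 0"
    by (simp add: siegel_eq_0_iff)
  moreover have "(cmod (siegel h))\<^sup>2 = (Re (siegel h))\<^sup>2 + (Im (siegel h))\<^sup>2"
    by (rule cmod_power2)
  ultimately show ?thesis
    by (subst siegel_def)
      (simp add: koranyi_inv_siegel complex_eq_iff Re_divide Im_divide norm_divide power_divide,
        simp add: siegel_def)
qed

lemma koranyi_inv_eq_0_iff: "koranyi_inv h = 0 \<longleftrightarrow> h = 0"
  using siegel_koranyi_inv[of h] siegel_eq_0_iff[of h] siegel_eq_0_iff[of "koranyi_inv h"]
  by auto

lemma koranyi_inv_koranyi_inv: "koranyi_inv (koranyi_inv h) = h"
proof (cases "h = 0")
  case True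
  then show ?thesis by (simp add: koranyi_inv_eq_0_iff)
next
  case False
  then have "siegel h \<noteq> 0" by (simp add: siegel_eq_0_iff)
  then show ?thesis
    by (subst koranyi_inv_siegel, unfold siegel_koranyi_inv)
      (simp add: koranyi_inv_siegel norm_divide power_divide prod_eq_iff)
qed

text \<open>Componentwise negation is the group inverse, because \<open>cnj a * a\<close> is real
  and so the twist of \<open>a\<close> with itself vanishes.\<close>

lemma heis_mult_cancel: "g \<odot> (- g \<odot> h) = h"
  by (simp add: heis_mult_def prod_eq_iff algebra_simps)

lemma gaussian_ints_closed:
  assumes "a \<in> gaussian_ints" "b \<in> gaussian_ints"
  shows "a + b \<in> gaussian_ints" "a * b \<in> gaussian_ints" "- a \<in> gaussian_ints"
    "cnj a \<in> gaussian_ints"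
  using assms by (auto simp: gaussian_ints_def)

lemma numeral_in_gaussian_ints: "numeral k \<in> gaussian_ints"
  by (simp add: gaussian_ints_def)

lemma uminus_in_heis_int: "g \<in> heis_int \<Longrightarrow> - g \<in> heis_int"
  by (auto simp: heis_int_def gaussian_ints_def)

lemma siegel_in_gaussian_ints: "g \<in> heis_int \<Longrightarrow> siegel g \<in> gaussian_ints"
  by (auto simp: siegel_def heis_int_def gaussian_ints_def cmod_power2)

text \<open>Supplies the natural number on which the Euclidean descent is well-founded.\<close>

lemma gaussian_int_norm_nat:
  assumes "a \<in> gaussian_ints"
  obtains n :: nat where "(cmod a)\<^sup>2 = real n"
proof -
  from assms have "(cmod a)\<^sup>2 \<in> \<int>"
    by (simp add: cmod_power2 gaussian_ints_def)
  then have "(cmod a)\<^sup>2 \<in> \<nat>"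
    by (simp add: Nats_altdef2)
  then show ?thesis
    using that by (auto elim: Nats_cases)
qed

text \<open>Rounding leaves \<open>|z|^2 \<le> 1/2\<close> and \<open>|t| \<le> 1/2\<close>, so that
  \<open>|w|^2 = |z|^4 + t^2 \<le> 1/2\<close>.\<close>

lemma heis_int_approx:
  obtains g where "g \<in> heis_int" "cmod (siegel (- g \<odot> h)) < 1"
proof -
  define a where "a = Complex (of_int (round (Re (fst h)))) (of_int (round (Im (fst h))))"
  \<comment> \<open>The horizontal translation by \<open>- a\<close> also shifts the vertical
    coordinate, so \<open>a\<close> is fixed first and the shifted height \<open>s\<close> is
    rounded afterwards.\<close>
  define s where "s = snd h + 2 * Im (cnj (- a) * fst h)"
  define g where "g = (a, of_int (round s) :: real)"
  have small: "(x - of_int (round x))\<^sup>2 \<le> 1 / 4" for x :: real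
    using power_mono[OF of_int_round_abs_le[of x], of 2]
    by (simp add: power2_eq_square abs_minus_commute algebra_simps)
  have "(cmod (fst h - a))\<^sup>2 \<le> 1 / 2"
    using small[of "Re (fst h)"] small[of "Im (fst h)"]
    by (simp add: cmod_power2 a_def)
  from power_mono[OF this, of 2] have "cmod (fst h - a) ^ 4 \<le> 1 / 4"
    by (simp add: power_divide)
  then have "(cmod (siegel (- g \<odot> h)))\<^sup>2 \<le> 1 / 4 + 1 / 4"
    using small[of s]
    unfolding norm_siegel_squared
    by (simp add: g_def s_def heis_mult_def algebra_simps)
  then have "cmod (siegel (- g \<odot> h)) < 1"
    using abs_square_less_1[of "cmod (siegel (- g \<odot> h))"] by simp
  moreover have "g \<in> heis_int"
    by (simp add: g_def a_def heis_int_def gaussian_ints_def)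
  ultimately show ?thesis by (rule that[rotated])
qed

definition heis_cfrac_expansible :: "heis \<Rightarrow> bool" where
  "heis_cfrac_expansible h \<longleftrightarrow> (\<exists>n \<gamma>. (\<forall>i\<le>n. \<gamma> i \<in> heis_int) \<and>
     heis_cfrac_defined \<gamma> n \<and> h = heis_cfrac \<gamma> n)"

lemma heis_int_expansible: "g \<in> heis_int \<Longrightarrow> heis_cfrac_expansible g"
  unfolding heis_cfrac_expansible_def
  by (rule exI[of _ 0], rule exI[of _ "\<lambda>_. g"]) simp

lemma heis_mult_koranyi_inv_expansible:
  assumes "g \<in> heis_int" "heis_cfrac_expansible h" "h \<noteq> 0"
  shows "heis_cfrac_expansible (g \<odot> koranyi_inv h)"
proof -
  from assms(2) obtain n \<gamma> where "\<forall>i\<le>n. \<gamma> i \<in> heis_int"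
    "heis_cfrac_defined \<gamma> n" "h = heis_cfrac \<gamma> n"
    unfolding heis_cfrac_expansible_def by blast
  then show ?thesis
    using assms(1,3) unfolding heis_cfrac_expansible_def
    \<comment> \<open>\<open>case_nat g \<gamma>\<close> puts \<open>g\<close> in front of the old
      digits; \<open>h \<noteq> 0\<close> is what definedness asks of the new outermost
      inversion.\<close>
    by (intro exI[of _ "Suc n"] exI[of _ "case_nat g \<gamma>"]) (auto split: nat.split)
qed

text \<open>Strong induction on \<open>|q|^2\<close>, the squared norm of the common denominator of
  \<open>z\<close> and \<open>w\<close>. The descent stops when the translated point is
  \<open>0\<close>, that is, when \<open>h\<close> is itself an integer point.\<close>

lemma expansible_if_gaussian_quotients:
  assumes "p \<in> gaussian_ints" "q \<in> gaussian_ints" "r \<in> gaussian_ints" "q \<noteq> 0"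
    and "fst h = r / q" "siegel h = p / q"
  shows "heis_cfrac_expansible h"
proof -
  from assms(2) obtain N where "(cmod q)\<^sup>2 = real N"
    by (rule gaussian_int_norm_nat)
  then show ?thesis
    using assms
  proof (induction N arbitrary: p q r h rule: less_induct)
    case (less N p q r h)
    obtain g where g: "g \<in> heis_int" and small: "cmod (siegel (- g \<odot> h)) < 1"
      by (rule heis_int_approx)
    define h' where "h' = - g \<odot> h"
    have h: "h = g \<odot> h'"
      by (simp add: h'_def heis_mult_cancel)
    show ?case
    proof (cases "h' = 0")
      case True
      then have "h = g" by (simp add: h heis_mult_def)
      with g show ?thesis by (simp add: heis_int_expansible)
    next
      case False
      \<comment> \<open>The numerators of \<open>z\<close> and \<open>w\<close> after translation by
        \<open>- g\<close>, still over the denominator \<open>q\<close>; \<open>p'\<close> comes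
        from \<open>siegel_mult\<close>.\<close>
      define r' where "r' = r + (- fst g) * q"
      define p' where "p' = p + siegel (- g) * q + 2 * cnj (- fst g) * r"
      have "fst g \<in> gaussian_ints"
        using g by (auto simp: heis_int_def)
      then have ints: "r' \<in> gaussian_ints" "- r' \<in> gaussian_ints" "p' \<in> gaussian_ints"
        unfolding r'_def p'_def using less.prems g
        by (intro gaussian_ints_closed numeral_in_gaussian_ints siegel_in_gaussian_ints
            uminus_in_heis_int; simp)+
      have z: "fst h' = r' / q"
        using less.prems by (simp add: h'_def r'_def heis_mult_def field_simps)
      have w: "siegel h' = p' / q"
        using less.prems by (simp add: h'_def p'_def siegel_mult field_simps)
      have "p' \<noteq> 0"
        using w False by (auto simp: siegel_eq_0_iff)
      have "cmod p' < cmod q"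
        using small w \<open>q \<noteq> 0\<close> by (simp add: h'_def[symmetric] norm_divide divide_simps)
      then have "(cmod p')\<^sup>2 < real N"
        using less.prems(1) by (metis norm_ge_zero power_strict_mono zero_less_numeral)
      moreover obtain M where M: "(cmod p')\<^sup>2 = real M"
        using ints(3) by (rule gaussian_int_norm_nat)
      ultimately have "M < N" by simp
      \<comment> \<open>Dividing \<open>r' / q\<close> by \<open>p' / q\<close> cancels
        \<open>q\<close>, so \<open>p'\<close> becomes the common denominator, and its norm is
        smaller.\<close>
      moreover have "fst (koranyi_inv h') = - r' / p'"
        using \<open>q \<noteq> 0\<close> by (simp add: koranyi_inv_siegel z w)
      moreover have "siegel (koranyi_inv h') = q / p'"
        by (simp add: siegel_koranyi_inv w)
      ultimately have "heis_cfrac_expansible (koranyi_inv h')"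
        using less.IH[of M p' q "- r'"] M ints less.prems \<open>p' \<noteq> 0\<close> by blast
      \<comment> \<open>Since the inversion is an involution, this point is
        \<open>g \<odot> h'\<close>, which equals \<open>h\<close>.\<close>
      then have "heis_cfrac_expansible (g \<odot> koranyi_inv (koranyi_inv h'))"
        using g False by (intro heis_mult_koranyi_inv_expansible)
          (simp_all add: koranyi_inv_eq_0_iff)
      then show ?thesis
        by (simp add: koranyi_inv_koranyi_inv h)
    qed
  qed
qed

lemma Rats_common_denominator:
  fixes x y t :: real
  assumes "x \<in> \<rat>" "y \<in> \<rat>" "t \<in> \<rat>"
  obtains d :: real where "d \<in> \<int>" "d \<noteq> 0" "x * d \<in> \<int>" "y * d \<in> \<int>" "t * d \<in> \<int>"
proof -
  have *: "\<exists>b::real. b \<in> \<int> \<and> b \<noteq> 0 \<and> u * b \<in> \<int>" if "u \<in> \<rat>" for u :: real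
  proof -
    from that obtain m n where "n > 0" "u = of_int m / of_int n"
      by (rule Rats_cases')
    then show ?thesis
      by (intro exI[of _ "of_int n"]) simp
  qed
  from *[OF assms(1)] *[OF assms(2)] *[OF assms(3)] obtain a b c where
    abc: "a \<in> \<int>" "a \<noteq> 0" "x * a \<in> \<int>" "b \<in> \<int>" "b \<noteq> 0" "y * b \<in> \<int>" "c \<in> \<int>" "c \<noteq> 0" "t * c \<in> \<int>"
    by blast
  have "x * (a * b * c) = (x * a) * b * c" "y * (a * b * c) = (y * b) * a * c"
    "t * (a * b * c) = (t * c) * a * b"
    by simp_all
  with abc show ?thesis
    by (intro that[of "a * b * c"]) (simp_all only: Ints_mult, simp)
qed

lemma heis_rat_expansible:
  assumes "h \<in> heis_rat"
  shows "heis_cfrac_expansible h"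
proof -
  obtain x y t where h: "h = (Complex x y, t)"
    by (metis complex.exhaust surj_pair)
  with assms have "x \<in> \<rat>" "y \<in> \<rat>" "t \<in> \<rat>"
    by (auto simp: heis_rat_def gaussian_rats_def)
  then obtain d where d: "d \<in> \<int>" "d \<noteq> 0" "x * d \<in> \<int>" "y * d \<in> \<int>" "t * d \<in> \<int>"
    by (rule Rats_common_denominator)
  \<comment> \<open>The factor \<open>d\<close> clears the denominators of \<open>z\<close> and
    \<open>t\<close>, but \<open>|z|^2\<close> is quadratic in the coordinates and calls for
    \<open>d * d\<close>.\<close>
  define q where "q = complex_of_real (d * d)"
  have "Re (siegel h * q) = (x * d) * (x * d) + (y * d) * (y * d)"
    by (simp add: siegel_def h q_def cmod_power2) (simp add: power2_eq_square algebra_simps)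
  moreover have "Im (siegel h * q) = (t * d) * d"
    by (simp add: siegel_def h q_def)
  ultimately have "siegel h * q \<in> gaussian_ints"
    using d by (simp add: gaussian_ints_def)
  moreover have "q \<in> gaussian_ints" "q \<noteq> 0"
    using d by (simp_all add: gaussian_ints_def q_def)
  moreover have "Re (fst h * q) = (x * d) * d" "Im (fst h * q) = (y * d) * d"
    by (simp_all add: h q_def)
  then have "fst h * q \<in> gaussian_ints"
    using d by (simp add: gaussian_ints_def)
  ultimately show ?thesis
    by (intro expansible_if_gaussian_quotients[of "siegel h * q" q "fst h * q"]) simp_all
qed

lemma heis_int_subset_heis_rat: "heis_int \<subseteq> heis_rat"
  using Ints_subset_Rats
  by (auto simp: heis_int_def heis_rat_def gaussian_ints_def gaussian_rats_def)

lemma heis_mult_in_heis_rat: "g \<in> heis_rat \<Longrightarrow> h \<in> heis_rat \<Longrightarrow> g \<odot> h \<in> heis_rat"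
  by (auto simp: heis_rat_def gaussian_rats_def heis_mult_def)

lemma koranyi_inv_in_heis_rat:
  assumes "h \<in> heis_rat"
  shows "koranyi_inv h \<in> heis_rat"
proof -
  have "Re (siegel h) \<in> \<rat>" "Im (siegel h) \<in> \<rat>"
    using assms by (auto simp: siegel_def heis_rat_def gaussian_rats_def cmod_power2)
  with assms show ?thesis
    unfolding koranyi_inv_siegel
    by (auto simp: heis_rat_def gaussian_rats_def cmod_power2 Re_divide Im_divide)
qed

text \<open>Integer points are rational, and rational points are closed under the product and under
  the inversion, whose value at \<open>0\<close> is again \<open>0\<close>.\<close>

lemma heis_cfrac_in_heis_rat:
  "\<forall>i\<le>n. \<gamma> i \<in> heis_int \<Longrightarrow> heis_cfrac \<gamma> n \<in> heis_rat"
proof (induction n arbitrary: \<gamma>)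
  case 0
  then show ?case using heis_int_subset_heis_rat by auto
next
  case (Suc n)
  then have "heis_cfrac (\<lambda>i. \<gamma> (Suc i)) n \<in> heis_rat" by simp
  moreover have "\<gamma> 0 \<in> heis_rat"
    using Suc.prems heis_int_subset_heis_rat by auto
  ultimately show ?case
    by (simp add: heis_mult_in_heis_rat koranyi_inv_in_heis_rat)
qed

theorem theorem3p10:
  fixes h :: heis
  shows "h \<in> heis_rat \<longleftrightarrow>
    (\<exists>(n::nat) (\<gamma>::nat \<Rightarrow> heis).
       (\<forall>i\<le>n. \<gamma> i \<in> heis_int) \<and> heis_cfrac_defined \<gamma> n \<and> h = heis_cfrac \<gamma> n)"
  using heis_rat_expansible[of h] heis_cfrac_in_heis_rat
  unfolding heis_cfrac_expansible_def by blast

end
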